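(* Let $b\le a$ and $\beta\neq0$ be real with $a\ne\pm b$, let $\alpha=-\frac12(a+b)$, and let $$u(x)=a+\frac{(b-a)(1-\mathrm{cn}(\nu x;\kappa))}{1+\delta+(\delta-1)\,\mathrm{cn}(\nu x;\kappa)},$$ where $\delta>0$, $\nu>0$, $\kappa\in(0,1)$ are given by $$\delta^2=\frac{(b-\alpha)^2+\beta^2}{(a-\alpha)^2+\beta^2},\quad \nu^2=\sqrt{[(a-\alpha)^2+\beta^2][(b-\alpha)^2+\beta^2]},\quad 2\kappa^2=1-\frac{(a-\alpha)(b-\alpha)+\beta^2}{\sqrt{[(a-\alpha)^2+\beta^2][(b-\alpha)^2+\beta^2]}} .$$ Let $\lambda_1=\frac14(a-b)+\frac i2\beta$, $\lambda_2=\frac14(a-b)-\frac i2\beta$, $\lambda_3=\frac12(a+b)$. (1) The one-fold Darboux transformation with the periodic eigenfunction for $\lambda_3$ transforms $u$ to the periodic wave of the same period obtained from $u$ after the symmetry transformation $(S0)$ and the reflection $u\mapsto-u$. (2) The two-fold Darboux transformation with the periodic eigenfunctions for $\lambda_1$ and $\lambda_2$ transforms $u$ to the periodic wave of the same period obtained from $u$ after the symmetry transformation $(S0)$. (3) The three-fold Darboux transformation with the periodic eigenfunctions for all three eigenvalues $\lambda_1,\lambda_2,\lambda_3$ maps $u$ to itself reflected with $u\mapsto-u$.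
   Context: $\mathrm{cn}(\cdot;\kappa)$ is the Jacobian elliptic function with modulus $\kappa$. The symmetry transformation $(S0)$ is the exchange $a\leftrightarrow b$ in the formula for $u$ and its parameters ($\nu,\kappa$ are unchanged and $\delta\mapsto\delta^{-1}$). Let $c=-(ab+2\alpha(a+b)+\alpha^2+\beta^2)$ and $2e=2\alpha ab+(a+b)(\alpha^2+\beta^2)$. Then $u(x-ct)$ solves the modified Korteweg--de Vries equation $u_t+6u^2u_x+u_{xxx}=0$. The periodic eigenfunction for $\lambda_j$ is the solution $\varphi=(p_j,q_j)^t$ (unique up to scalar multiplication) of $\varphi_x=\begin{pmatrix}\lambda&u\\-u&-\lambda\end{pmatrix}\varphi$ with $\lambda=\lambda_j$ whose squared components are, up to a common nonzero constant factor $m_j$, $$p_j^2+q_j^2=m_j(e+4\lambda_j^2u),\quad p_j^2-q_j^2=2m_j\lambda_ju_x,\quad 2p_jq_j=m_j\lambda_j(c-4\lambda_j^2-2u^2).$$ The Darboux transformations of $u$ with solutions $(p_j,q_j)$ for $\lambda_j$ are: one-fold (with $(\lambda_1,p_1,q_1)$ standing for the chosen data) $$\tilde u=u+\frac{4\lambda_1p_1q_1}{p_1^2+q_1^2};$$ two-fold $$\tilde u=u+\frac{4(\lambda_1^2-\lambda_2^2)[\lambda_1p_1q_1(p_2^2+q_2^2)-\lambda_2p_2q_2(p_1^2+q_1^2)]}{(\lambda_1^2+\lambda_2^2)(p_1^2+q_1^2)(p_2^2+q_2^2)-2\lambda_1\lambda_2[4p_1q_1p_2q_2+(p_1^2-q_1^2)(p_2^2-q_2^2)]};$$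 three-fold $\tilde u=u+4N/D$ with $$\begin{aligned}N=&(\lambda_3^2-\lambda_1^2)(\lambda_3^2-\lambda_2^2)\lambda_3p_3q_3[(\lambda_1^2+\lambda_2^2)(p_1^2+q_1^2)(p_2^2+q_2^2)-2\lambda_1\lambda_2(p_1^2-q_1^2)(p_2^2-q_2^2)]\\&+(\lambda_2^2-\lambda_1^2)(\lambda_2^2-\lambda_3^2)\lambda_2p_2q_2[(\lambda_1^2+\lambda_3^2)(p_1^2+q_1^2)(p_3^2+q_3^2)-2\lambda_1\lambda_3(p_1^2-q_1^2)(p_3^2-q_3^2)]\\&+(\lambda_1^2-\lambda_2^2)(\lambda_1^2-\lambda_3^2)\lambda_1p_1q_1[(\lambda_2^2+\lambda_3^2)(p_2^2+q_2^2)(p_3^2+q_3^2)-2\lambda_2\lambda_3(p_2^2-q_2^2)(p_3^2-q_3^2)]\\&-8(\lambda_1^4+\lambda_2^4+\lambda_3^4-\lambda_1^2\lambda_2^2-\lambda_1^2\lambda_3^2-\lambda_2^2\lambda_3^2)\lambda_1\lambda_2\lambda_3p_1p_2p_3q_1q_2q_3,\end{aligned}$$ $$\begin{aligned}D=&(\lambda_1+\lambda_2)^2(\lambda_1+\lambda_3)^2(\lambda_2-\lambda_3)^2(p_1^2q_2^2q_3^2+q_1^2p_2^2p_3^2)+(\lambda_1+\lambda_2)^2(\lambda_2+\lambda_3)^2(\lambda_1-\lambda_3)^2(p_2^2q_1^2q_3^2+q_2^2p_1^2p_3^2)\\&+(\lambda_1+\lambda_3)^2(\lambda_2+\lambda_3)^2(\lambda_1-\lambda_2)^2(p_3^2q_1^2q_2^2+q_3^2p_1^2p_2^2)+(\lambda_1-\lambda_2)^2(\lambda_1-\lambda_3)^2(\lambda_2-\lambda_3)^2(p_1^2p_2^2p_3^2+q_1^2q_2^2q_3^2)\\&-8(\lambda_3^2-\lambda_1^2)(\lambda_3^2-\lambda_2^2)\lambda_1\lambda_2p_1p_2q_1q_2(p_3^2+q_3^2)-8(\lambda_2^2-\lambda_1^2)(\lambda_2^2-\lambda_3^2)\lambda_1\lambda_3p_1p_3q_1q_3(p_2^2+q_2^2)\\&-8(\lambda_1^2-\lambda_2^2)(\lambda_1^2-\lambda_3^2)\lambda_2\lambda_3p_2p_3q_2q_3(p_1^2+q_1^2).\end{aligned}$$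 *)

theory Defs
  imports "HOL-Analysis.Analysis" "HOL-Library.Periodic_Fun"
begin

text \<open>
  The second argument \<open>k\<close> is always the modulus, not the parameter \<open>k\<^sup>2\<close>. The interval
  integral is signed, so that \<open>elliptic_F\<close> is odd in \<open>\<phi>\<close>.
\<close>

definition elliptic_F :: "real \<Rightarrow> real \<Rightarrow> real" where
  "elliptic_F \<phi> k = (LBINT \<theta>=0..\<phi>. 1 / sqrt (1 - k\<^sup>2 * (sin \<theta>)\<^sup>2))"

definition jacobi_am :: "real \<Rightarrow> real \<Rightarrow> real" where
  "jacobi_am x k = (THE \<phi>. elliptic_F \<phi> k = x)"

definition jacobi_cn :: "real \<Rightarrow> real \<Rightarrow> real" where
  "jacobi_cn x k = cos (jacobi_am x k)"

lemma elliptic_radicand_pos: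
  fixes k :: real
  assumes "0 < k" "k < 1"
  shows "0 < 1 - k\<^sup>2 * (sin \<theta>)\<^sup>2" "1 - k\<^sup>2 * (sin \<theta>)\<^sup>2 \<le> 1"
proof -
  have "k\<^sup>2 < 1" using assms by (simp add: power_less_one_iff)
  moreover have "k\<^sup>2 * (sin \<theta>)\<^sup>2 \<le> k\<^sup>2 * 1"
    by (intro mult_left_mono) (simp_all add: abs_square_le_1)
  ultimately show "0 < 1 - k\<^sup>2 * (sin \<theta>)\<^sup>2" by linarith
  show "1 - k\<^sup>2 * (sin \<theta>)\<^sup>2 \<le> 1" by simp
qed

lemma elliptic_F_has_derivative:
  assumes k: "0 < k" "k < 1"
  shows "((\<lambda>\<phi>. elliptic_F \<phi> k) has_real_derivative
           1 / sqrt (1 - k\<^sup>2 * (sin \<phi>)\<^sup>2)) (at \<phi>)"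
proof -
  let ?f = "\<lambda>\<theta>. 1 / sqrt (1 - k\<^sup>2 * (sin \<theta>)\<^sup>2)"
  let ?a = "- \<bar>\<phi>\<bar> - 1" and ?b = "\<bar>\<phi>\<bar> + 1"
  have pos: "k\<^sup>2 * (sin \<theta>)\<^sup>2 \<noteq> 1" for \<theta>
    using elliptic_radicand_pos(1)[OF k, of \<theta>] by linarith
  have "continuous_on {?a..?b} ?f"
    by (intro continuous_intros ballI) (simp add: pos)
  then have "((\<lambda>u. LBINT y=ereal 0..ereal u. ?f y) has_vector_derivative ?f \<phi>) (at \<phi> within {?a..?b})"
    by (intro interval_integral_FTC2) auto
  moreover have "at \<phi> within {?a..?b} = at \<phi>"
    by (intro at_within_interior) (auto simp: interior_atLeastAtMost_real)
  ultimately show ?thesis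
    by (simp add: elliptic_F_def has_real_derivative_iff_has_vector_derivative zero_ereal_def)
qed

lemma jacobi_am_ex1:
  assumes k: "0 < k" "k < 1"
  shows "\<exists>!\<phi>. elliptic_F \<phi> k = x"
proof -
  let ?F = "\<lambda>\<phi>. elliptic_F \<phi> k"
  let ?f = "\<lambda>\<theta>. 1 / sqrt (1 - k\<^sup>2 * (sin \<theta>)\<^sup>2)"
  have ge1: "?f \<theta> \<ge> 1" for \<theta>
    using elliptic_radicand_pos[OF k, of \<theta>] by simp
  have growth: "t - s \<le> ?F t - ?F s" if "s \<le> t" for s t
  proof -
    have "?F s - s \<le> ?F t - t"
    proof (rule DERIV_nonneg_imp_nondecreasing[OF that])
      fix y
      have "((\<lambda>\<phi>. ?F \<phi> - \<phi>) has_real_derivative ?f y - 1) (at y)"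
        by (intro DERIV_diff elliptic_F_has_derivative[OF k] DERIV_ident)
      then show "\<exists>z. ((\<lambda>\<phi>. ?F \<phi> - \<phi>) has_real_derivative z) (at y) \<and> 0 \<le> z"
        using ge1[of y] by (intro exI[of _ "?f y - 1"]) simp
    qed
    then show ?thesis by simp
  qed
  have F0: "?F 0 = 0"
    by (simp add: elliptic_F_def zero_ereal_def)
  have "continuous_on {- \<bar>x\<bar>..\<bar>x\<bar>} ?F"
    using elliptic_F_has_derivative[OF k] by (meson DERIV_continuous_on has_field_derivative_at_within)
  moreover have "?F (- \<bar>x\<bar>) \<le> x" "x \<le> ?F \<bar>x\<bar>"
    using growth[of "- \<bar>x\<bar>" 0] growth[of 0 "\<bar>x\<bar>"] F0 by auto
  ultimately obtain \<phi> where "?F \<phi> = x"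
    using IVT'[of ?F "- \<bar>x\<bar>" x "\<bar>x\<bar>"] by auto
  moreover have "s = t" if "?F s = x" "?F t = x" for s t
    using growth[of s t] growth[of t s] that by linarith
  ultimately show ?thesis by blast
qed

definition cn_wave_parameters ::
    "real \<Rightarrow> real \<Rightarrow> real \<Rightarrow> real \<Rightarrow> real \<Rightarrow> real \<Rightarrow> real \<Rightarrow> bool" where
  "cn_wave_parameters a b \<alpha> \<beta> \<delta> \<nu> \<kappa> \<longleftrightarrow>
     \<delta> > 0 \<and> \<nu> > 0 \<and> 0 < \<kappa> \<and> \<kappa> < 1 \<and>
     \<delta>\<^sup>2 = ((b - \<alpha>)\<^sup>2 + \<beta>\<^sup>2) / ((a - \<alpha>)\<^sup>2 + \<beta>\<^sup>2) \<and>
     \<nu>\<^sup>2 = sqrt (((a - \<alpha>)\<^sup>2 + \<beta>\<^sup>2) * ((b - \<alpha>)\<^sup>2 + \<beta>\<^sup>2)) \<and>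
     2 * \<kappa>\<^sup>2 = 1 - ((a - \<alpha>) * (b - \<alpha>) + \<beta>\<^sup>2) /
                      sqrt (((a - \<alpha>)\<^sup>2 + \<beta>\<^sup>2) * ((b - \<alpha>)\<^sup>2 + \<beta>\<^sup>2))"

definition cn_wave :: "real \<Rightarrow> real \<Rightarrow> real \<Rightarrow> real \<Rightarrow> real \<Rightarrow> real \<Rightarrow> real" where
  "cn_wave a b \<delta> \<nu> \<kappa> x =
     a + (b - a) * (1 - jacobi_cn (\<nu> * x) \<kappa>) / (1 + \<delta> + (\<delta> - 1) * jacobi_cn (\<nu> * x) \<kappa>)"

text \<open>
  The symmetry transformation (S0) exchanges \<open>a\<close> and \<open>b\<close>; the lemma below shows that
  \<open>1 / \<delta>, \<nu>, \<kappa>\<close> are the parameters that belong to the exchanged pair \<open>(b, a)\<close>.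
\<close>

definition cn_wave_S0 :: "real \<Rightarrow> real \<Rightarrow> real \<Rightarrow> real \<Rightarrow> real \<Rightarrow> real \<Rightarrow> real" where
  "cn_wave_S0 a b \<delta> \<nu> \<kappa> = cn_wave b a (1 / \<delta>) \<nu> \<kappa>"

lemma cn_wave_parameters_S0:
  "cn_wave_parameters a b \<alpha> \<beta> \<delta> \<nu> \<kappa> \<Longrightarrow> cn_wave_parameters b a \<alpha> \<beta> (1 / \<delta>) \<nu> \<kappa>"
  by (simp add: cn_wave_parameters_def power_divide mult.commute)

definition fundamental_period :: "(real \<Rightarrow> 'b) \<Rightarrow> real \<Rightarrow> bool" where
  "fundamental_period f T \<longleftrightarrow>
     T > 0 \<and> periodic_fun_simple f T \<and> (\<forall>S>0. periodic_fun_simple f S \<longrightarrow> T \<le> S)"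

text \<open>
  The wave satisfies \<open>u'' + 2 * u ^ 3 = c * u + e\<close>, and \<open>u (x - c * t)\<close> solves the modified KdV
  equation.
\<close>

definition mkdv_c :: "real \<Rightarrow> real \<Rightarrow> real \<Rightarrow> real \<Rightarrow> real" where
  "mkdv_c a b \<alpha> \<beta> = - (a * b + 2 * \<alpha> * (a + b) + \<alpha>\<^sup>2 + \<beta>\<^sup>2)"

definition mkdv_e :: "real \<Rightarrow> real \<Rightarrow> real \<Rightarrow> real \<Rightarrow> real" where
  "mkdv_e a b \<alpha> \<beta> = (2 * \<alpha> * a * b + (a + b) * (\<alpha>\<^sup>2 + \<beta>\<^sup>2)) / 2"

definition spectral_solution ::
    "(real \<Rightarrow> real) \<Rightarrow> complex \<Rightarrow> (real \<Rightarrow> complex) \<Rightarrow> (real \<Rightarrow> complex) \<Rightarrow> bool" where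
  "spectral_solution u l p q \<longleftrightarrow>
     (\<forall>x. (p has_vector_derivative (l * p x + of_real (u x) * q x)) (at x) \<and>
          (q has_vector_derivative (- of_real (u x) * p x - l * q x)) (at x))"

definition periodic_eigenfunction ::
    "real \<Rightarrow> real \<Rightarrow> (real \<Rightarrow> real) \<Rightarrow> complex \<Rightarrow> (real \<Rightarrow> complex) \<Rightarrow> (real \<Rightarrow> complex) \<Rightarrow> bool" where
  "periodic_eigenfunction c e u l p q \<longleftrightarrow>
     spectral_solution u l p q \<and>
     (\<exists>m. m \<noteq> 0 \<and> (\<forall>x.
        (p x)\<^sup>2 + (q x)\<^sup>2 = m * (of_real e + 4 * l\<^sup>2 * of_real (u x)) \<and>
        (p x)\<^sup>2 - (q x)\<^sup>2 = 2 * m * l * of_real (deriv u x) \<and>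
        2 * p x * q x = m * l * (of_real c - 4 * l\<^sup>2 - 2 * of_real ((u x)\<^sup>2))))"

text \<open>
  Each transformation is split into a numerator and a denominator, functions of the values of the
  eigenfunctions at one point, so that the denominator can be required not to vanish.
\<close>

definition darboux1_num :: "complex \<Rightarrow> complex \<Rightarrow> complex \<Rightarrow> complex" where
  "darboux1_num l1 p1 q1 = l1 * p1 * q1"

definition darboux1_den :: "complex \<Rightarrow> complex \<Rightarrow> complex" where
  "darboux1_den p1 q1 = p1\<^sup>2 + q1\<^sup>2"

definition darboux1 ::
    "(real \<Rightarrow> real) \<Rightarrow> complex \<Rightarrow> (real \<Rightarrow> complex) \<Rightarrow> (real \<Rightarrow> complex) \<Rightarrow> real \<Rightarrow> complex" where
  "darboux1 u l1 p1 q1 x =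
     of_real (u x) + 4 * darboux1_num l1 (p1 x) (q1 x) / darboux1_den (p1 x) (q1 x)"

definition darboux2_num ::
    "complex \<Rightarrow> complex \<Rightarrow> complex \<Rightarrow> complex \<Rightarrow> complex \<Rightarrow> complex \<Rightarrow> complex" where
  "darboux2_num l1 l2 p1 q1 p2 q2 =
     (l1\<^sup>2 - l2\<^sup>2) * (l1 * p1 * q1 * (p2\<^sup>2 + q2\<^sup>2) - l2 * p2 * q2 * (p1\<^sup>2 + q1\<^sup>2))"

definition darboux2_den ::
    "complex \<Rightarrow> complex \<Rightarrow> complex \<Rightarrow> complex \<Rightarrow> complex \<Rightarrow> complex \<Rightarrow> complex" where
  "darboux2_den l1 l2 p1 q1 p2 q2 =
     (l1\<^sup>2 + l2\<^sup>2) * (p1\<^sup>2 + q1\<^sup>2) * (p2\<^sup>2 + q2\<^sup>2)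
     - 2 * l1 * l2 * (4 * p1 * q1 * p2 * q2 + (p1\<^sup>2 - q1\<^sup>2) * (p2\<^sup>2 - q2\<^sup>2))"

definition darboux2 ::
    "(real \<Rightarrow> real) \<Rightarrow> complex \<Rightarrow> complex \<Rightarrow> (real \<Rightarrow> complex) \<Rightarrow> (real \<Rightarrow> complex)
       \<Rightarrow> (real \<Rightarrow> complex) \<Rightarrow> (real \<Rightarrow> complex) \<Rightarrow> real \<Rightarrow> complex" where
  "darboux2 u l1 l2 p1 q1 p2 q2 x =
     of_real (u x) + 4 * darboux2_num l1 l2 (p1 x) (q1 x) (p2 x) (q2 x)
                       / darboux2_den l1 l2 (p1 x) (q1 x) (p2 x) (q2 x)"

definition darboux3_num ::
    "complex \<Rightarrow> complex \<Rightarrow> complex \<Rightarrow> complex \<Rightarrow> complex \<Rightarrow> complex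
       \<Rightarrow> complex \<Rightarrow> complex \<Rightarrow> complex \<Rightarrow> complex" where
  "darboux3_num l1 l2 l3 p1 q1 p2 q2 p3 q3 =
     (l3\<^sup>2 - l1\<^sup>2) * (l3\<^sup>2 - l2\<^sup>2) * l3 * p3 * q3 *
       ((l1\<^sup>2 + l2\<^sup>2) * (p1\<^sup>2 + q1\<^sup>2) * (p2\<^sup>2 + q2\<^sup>2) - 2 * l1 * l2 * (p1\<^sup>2 - q1\<^sup>2) * (p2\<^sup>2 - q2\<^sup>2))
   + (l2\<^sup>2 - l1\<^sup>2) * (l2\<^sup>2 - l3\<^sup>2) * l2 * p2 * q2 *
       ((l1\<^sup>2 + l3\<^sup>2) * (p1\<^sup>2 + q1\<^sup>2) * (p3\<^sup>2 + q3\<^sup>2) - 2 * l1 * l3 * (p1\<^sup>2 - q1\<^sup>2) * (p3\<^sup>2 - q3\<^sup>2))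
   + (l1\<^sup>2 - l2\<^sup>2) * (l1\<^sup>2 - l3\<^sup>2) * l1 * p1 * q1 *
       ((l2\<^sup>2 + l3\<^sup>2) * (p2\<^sup>2 + q2\<^sup>2) * (p3\<^sup>2 + q3\<^sup>2) - 2 * l2 * l3 * (p2\<^sup>2 - q2\<^sup>2) * (p3\<^sup>2 - q3\<^sup>2))
   - 8 * (l1^4 + l2^4 + l3^4 - l1\<^sup>2 * l2\<^sup>2 - l1\<^sup>2 * l3\<^sup>2 - l2\<^sup>2 * l3\<^sup>2) *
       l1 * l2 * l3 * p1 * p2 * p3 * q1 * q2 * q3"

definition darboux3_den ::
    "complex \<Rightarrow> complex \<Rightarrow> complex \<Rightarrow> complex \<Rightarrow> complex \<Rightarrow> complex
       \<Rightarrow> complex \<Rightarrow> complex \<Rightarrow> complex \<Rightarrow> complex" where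
  "darboux3_den l1 l2 l3 p1 q1 p2 q2 p3 q3 =
     (l1 + l2)\<^sup>2 * (l1 + l3)\<^sup>2 * (l2 - l3)\<^sup>2 * (p1\<^sup>2 * q2\<^sup>2 * q3\<^sup>2 + q1\<^sup>2 * p2\<^sup>2 * p3\<^sup>2)
   + (l1 + l2)\<^sup>2 * (l2 + l3)\<^sup>2 * (l1 - l3)\<^sup>2 * (p2\<^sup>2 * q1\<^sup>2 * q3\<^sup>2 + q2\<^sup>2 * p1\<^sup>2 * p3\<^sup>2)
   + (l1 + l3)\<^sup>2 * (l2 + l3)\<^sup>2 * (l1 - l2)\<^sup>2 * (p3\<^sup>2 * q1\<^sup>2 * q2\<^sup>2 + q3\<^sup>2 * p1\<^sup>2 * p2\<^sup>2)
   + (l1 - l2)\<^sup>2 * (l1 - l3)\<^sup>2 * (l2 - l3)\<^sup>2 * (p1\<^sup>2 * p2\<^sup>2 * p3\<^sup>2 + q1\<^sup>2 * q2\<^sup>2 * q3\<^sup>2)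
   - 8 * (l3\<^sup>2 - l1\<^sup>2) * (l3\<^sup>2 - l2\<^sup>2) * l1 * l2 * p1 * p2 * q1 * q2 * (p3\<^sup>2 + q3\<^sup>2)
   - 8 * (l2\<^sup>2 - l1\<^sup>2) * (l2\<^sup>2 - l3\<^sup>2) * l1 * l3 * p1 * p3 * q1 * q3 * (p2\<^sup>2 + q2\<^sup>2)
   - 8 * (l1\<^sup>2 - l2\<^sup>2) * (l1\<^sup>2 - l3\<^sup>2) * l2 * l3 * p2 * p3 * q2 * q3 * (p1\<^sup>2 + q1\<^sup>2)"

definition darboux3 ::
    "(real \<Rightarrow> real) \<Rightarrow> complex \<Rightarrow> complex \<Rightarrow> complex \<Rightarrow> (real \<Rightarrow> complex) \<Rightarrow> (real \<Rightarrow> complex)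
       \<Rightarrow> (real \<Rightarrow> complex) \<Rightarrow> (real \<Rightarrow> complex) \<Rightarrow> (real \<Rightarrow> complex) \<Rightarrow> (real \<Rightarrow> complex)
       \<Rightarrow> real \<Rightarrow> complex" where
  "darboux3 u l1 l2 l3 p1 q1 p2 q2 p3 q3 x =
     of_real (u x)
     + 4 * darboux3_num l1 l2 l3 (p1 x) (q1 x) (p2 x) (q2 x) (p3 x) (q3 x)
         / darboux3_den l1 l2 l3 (p1 x) (q1 x) (p2 x) (q2 x) (p3 x) (q3 x)"

end

theory Submission
  imports Defs
begin

text \<open>
  The numbers \<open>\<plusminus> l1, \<plusminus> l2, \<plusminus> l3\<close> parametrise the wave: \<open>c = 2 * (l1\<^sup>2 + l2\<^sup>2 + l3\<^sup>2)\<close> and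
  \<open>e = 4 * l1 * l2 * l3\<close>. The squares of the eigenfunctions are then polynomials in \<open>l1, l2, l3\<close>, the
  wave and its derivative, which enters the transformations only through its square and is
  eliminated by the first integral. After cancellation the one-fold and two-fold transformations
  become a fractional linear function of \<open>u\<close> and its negative, and the three-fold quotient
  becomes \<open>- u / 2\<close>. Both \<open>u\<close> and its (S0) image are injective fractional linear functions of
  \<open>cn\<close>, so all the waves inherit the period of \<open>cn\<close>.
\<close>

section \<open>Fundamental periods and the period of cn\<close>

text \<open>Being a period only concerns which values coincide. Hence injective images, also in
  another codomain such as the complex numbers, keep the fundamental period.\<close>

lemma fundamental_period_cong_ker:
  assumes "\<And>x y. f x = f y \<longleftrightarrow> g x = g y"
  shows "fundamental_period f T \<longleftrightarrow> fundamental_period g T"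
proof -
  have "periodic_fun_simple f S \<longleftrightarrow> periodic_fun_simple g S" for S
    unfolding periodic_fun_simple_def using assms by blast
  then show ?thesis by (simp add: fundamental_period_def)
qed

lemma elliptic_F_0: "elliptic_F 0 k = 0"
  by (simp add: elliptic_F_def zero_ereal_def)

context
  fixes k :: real
  assumes k: "0 < k" "k < 1"
begin

lemma elliptic_F_strict_mono: "s < t \<Longrightarrow> elliptic_F s k < elliptic_F t k"
proof (erule DERIV_pos_imp_increasing)
  fix y :: real
  show "\<exists>z. ((\<lambda>\<phi>. elliptic_F \<phi> k) has_real_derivative z) (at y) \<and> 0 < z"
    using elliptic_F_has_derivative[OF k, of y] elliptic_radicand_pos(1)[OF k, of y]
    by (intro exI conjI) auto
qed

text \<open>The integrand has period \<open>2 * pi\<close>, so both sides have the same derivative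
  in \<open>\<phi>\<close>, and they agree at 0.\<close>

lemma elliptic_F_plus_2pi: "elliptic_F (\<phi> + 2 * pi) k = elliptic_F \<phi> k + elliptic_F (2 * pi) k"
proof -
  let ?g = "\<lambda>\<phi>. elliptic_F (\<phi> + 2 * pi) k - elliptic_F \<phi> k"
  have "(?g has_real_derivative 0) (at y)" for y
  proof -
    have "((\<lambda>\<phi>. elliptic_F (\<phi> + 2 * pi) k) has_real_derivative
        1 / sqrt (1 - k\<^sup>2 * (sin (y + 2 * pi))\<^sup>2)) (at y)"
      using elliptic_F_has_derivative[OF k, of "y + 2 * pi"] by (simp only: DERIV_shift)
    from DERIV_diff[OF this elliptic_F_has_derivative[OF k]] show ?thesis by simp
  qed
  then have "?g \<phi> = ?g 0" by (intro DERIV_isconst_all) auto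
  then show ?thesis by (simp add: elliptic_F_0)
qed

lemma elliptic_F_jacobi_am: "elliptic_F (jacobi_am x k) k = x"
  unfolding jacobi_am_def by (rule theI'[OF jacobi_am_ex1[OF k]])

lemma jacobi_am_elliptic_F: "jacobi_am (elliptic_F \<phi> k) k = \<phi>"
  unfolding jacobi_am_def using jacobi_am_ex1[OF k] by (intro the1_equality) auto

text \<open>For minimality, compare a period \<open>S\<close> with the value 1 at the origin: the
  amplitude at \<open>\<nu> * S\<close> is a multiple of \<open>2 * pi\<close>, a positive one since
  \<open>elliptic_F\<close> is strictly increasing and vanishes at 0. The same monotonicity bounds
  \<open>\<nu> * S\<close> from below.\<close>

lemma fundamental_period_jacobi_cn:
  assumes "\<nu> > 0"
  shows "fundamental_period (\<lambda>x. jacobi_cn (\<nu> * x) k) (elliptic_F (2 * pi) k / \<nu>)"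
proof -
  let ?F = "\<lambda>\<phi>. elliptic_F \<phi> k"
  have "?F (2 * pi) > 0"
    using elliptic_F_strict_mono[of 0 "2 * pi"] by (simp add: elliptic_F_0)
  moreover have "jacobi_cn (x + ?F (2 * pi)) k = jacobi_cn x k" for x
    using jacobi_am_elliptic_F[of "jacobi_am x k + 2 * pi"]
    by (simp add: jacobi_cn_def elliptic_F_plus_2pi elliptic_F_jacobi_am)
  moreover have "?F (2 * pi) / \<nu> \<le> S"
    if S: "S > 0" and per: "periodic_fun_simple (\<lambda>x. jacobi_cn (\<nu> * x) k) S" for S
  proof -
    have am0: "jacobi_am 0 k = 0"
      using jacobi_am_elliptic_F[of 0] by (simp add: elliptic_F_0)
    have "cos (jacobi_am (\<nu> * S) k) = 1"
      using periodic_fun_simple.plus_period[OF per, of 0] by (simp add: jacobi_cn_def am0)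
    then obtain n :: int where n: "jacobi_am (\<nu> * S) k = n * 2 * pi"
      using cos_one_2pi_int by auto
    have "\<not> jacobi_am (\<nu> * S) k \<le> 0"
    proof
      assume "jacobi_am (\<nu> * S) k \<le> 0"
      then have "?F (jacobi_am (\<nu> * S) k) \<le> ?F 0"
        using elliptic_F_strict_mono by (auto simp: le_less)
      moreover have "\<nu> * S > 0" using S assms by simp
      ultimately show False by (simp add: elliptic_F_jacobi_am elliptic_F_0)
    qed
    then have "n \<ge> 1" using n by (simp add: mult_le_0_iff not_le zero_less_mult_iff)
    then have "2 * pi \<le> jacobi_am (\<nu> * S) k"
      by (simp add: n)
    then have "?F (2 * pi) \<le> \<nu> * S"
      using elliptic_F_strict_mono[of "2 * pi" "jacobi_am (\<nu> * S) k"]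
      by (cases "2 * pi = jacobi_am (\<nu> * S) k") (auto simp: elliptic_F_jacobi_am)
    then show ?thesis using assms by (simp add: field_simps)
  qed
  ultimately show ?thesis using assms
    by (auto simp: fundamental_period_def periodic_fun_simple_def distrib_left)
qed

end

section \<open>The wave and its (S0) image as fractional linear functions of cn\<close>

lemma jacobi_cn_bounds: "-1 \<le> jacobi_cn x k" "jacobi_cn x k \<le> 1"
  by (simp_all add: jacobi_cn_def)

lemma cn_wave_den_pos:
  fixes \<delta> C :: real
  assumes "\<delta> > 0" "-1 \<le> C" "C \<le> 1"
  shows "\<delta> * (1 + C) + (1 - C) > 0"
proof (cases "C = 1")
  case False
  then have "1 - C > 0" "\<delta> * (1 + C) \<ge> 0" using assms by auto
  then show ?thesis by linarith
qed (use assms in simp)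

text \<open>This form exhibits the wave as the mean of \<open>a\<close> and \<open>b\<close> with
  the nonnegative weights \<open>\<delta> * (1 + C)\<close> and \<open>1 - C\<close>.\<close>

lemma cn_wave_moebius:
  fixes a b \<delta> \<nu> \<kappa> x :: real
  defines "C \<equiv> jacobi_cn (\<nu> * x) \<kappa>"
  assumes "\<delta> > 0"
  shows "cn_wave a b \<delta> \<nu> \<kappa> x = (a * \<delta> * (1 + C) + b * (1 - C)) / (\<delta> * (1 + C) + (1 - C))"
proof -
  have "\<delta> * (1 + C) + (1 - C) > 0"
    using cn_wave_den_pos[OF assms(2)] jacobi_cn_bounds by (simp add: C_def)
  moreover have "1 + \<delta> + (\<delta> - 1) * C = \<delta> * (1 + C) + (1 - C)" by algebra
  ultimately show ?thesis
    unfolding cn_wave_def C_def[symmetric] by (simp add: field_simps)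
qed

lemma cn_wave_eq_iff:
  assumes "\<delta> > 0" "a \<noteq> b"
  shows "cn_wave a b \<delta> \<nu> \<kappa> x = cn_wave a b \<delta> \<nu> \<kappa> y
           \<longleftrightarrow> jacobi_cn (\<nu> * x) \<kappa> = jacobi_cn (\<nu> * y) \<kappa>"
proof -
  define C where "C = jacobi_cn (\<nu> * x) \<kappa>"
  define C' where "C' = jacobi_cn (\<nu> * y) \<kappa>"
  have pos: "\<delta> * (1 + C) + (1 - C) > 0" "\<delta> * (1 + C') + (1 - C') > 0"
    using cn_wave_den_pos[OF assms(1)] jacobi_cn_bounds by (simp_all add: C_def C'_def)
  \<comment> \<open>The factor \<open>2 * \<delta> * (a - b)\<close> is the determinant of the
    fractional linear map; it is nonzero, so the map is injective.\<close>
  have "(a * \<delta> * (1 + C) + b * (1 - C)) * (\<delta> * (1 + C') + (1 - C'))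
      - (a * \<delta> * (1 + C') + b * (1 - C')) * (\<delta> * (1 + C) + (1 - C))
      = 2 * \<delta> * (a - b) * (C - C')"
    by algebra
  then have "(a * \<delta> * (1 + C) + b * (1 - C)) * (\<delta> * (1 + C') + (1 - C'))
      = (a * \<delta> * (1 + C') + b * (1 - C')) * (\<delta> * (1 + C) + (1 - C)) \<longleftrightarrow> C = C'"
    using assms by (metis eq_iff_diff_eq_0 mult_eq_0_iff less_irrefl zero_neq_numeral)
  then show ?thesis using pos
    by (simp add: cn_wave_moebius[OF assms(1)] frac_eq_eq flip: C_def C'_def)
qed

text \<open>
  The factor \<open>(a - b)\<^sup>2 / 4 + \<beta>\<^sup>2 + 2 * (a + b) * z\<close> equals \<open>(a - \<alpha>)\<^sup>2 + \<beta>\<^sup>2\<close> at \<open>z = a\<close>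
  and \<open>(b - \<alpha>)\<^sup>2 + \<beta>\<^sup>2\<close> at \<open>z = b\<close>, and \<open>\<delta>\<^sup>2\<close> is the ratio of these values.
\<close>

lemma cn_wave_S0_moebius:
  fixes a b \<beta> \<delta> \<nu> \<kappa> x :: real
  defines "K \<equiv> (a - b)\<^sup>2 / 4 + \<beta>\<^sup>2"
  defines "z \<equiv> cn_wave a b \<delta> \<nu> \<kappa> x" and "v \<equiv> cn_wave_S0 a b \<delta> \<nu> \<kappa> x"
  assumes "\<beta> \<noteq> 0" and \<delta>: "\<delta> > 0"
    and \<delta>2: "\<delta>\<^sup>2 = ((b + (a + b) / 2)\<^sup>2 + \<beta>\<^sup>2) / ((a + (a + b) / 2)\<^sup>2 + \<beta>\<^sup>2)"
  shows "K + 2 * (a + b) * z > 0"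
    and "- v * (K + 2 * (a + b) * z) = K * z - (a + b) * (a * b + (a + b)\<^sup>2 / 4 + \<beta>\<^sup>2)"
proof -
  define C where "C = jacobi_cn (\<nu> * x) \<kappa>"
  define A where "A = (a + (a + b) / 2)\<^sup>2 + \<beta>\<^sup>2"
  define D where "D = \<delta> * (1 + C) + (1 - C)"
  define E where "E = 1 / \<delta> * (1 + C) + (1 - C)"
  have A: "A > 0" using assms(4) by (simp add: A_def add_nonneg_pos)
  have B: "(b + (a + b) / 2)\<^sup>2 + \<beta>\<^sup>2 = \<delta>\<^sup>2 * A"
    using A unfolding \<delta>2 A_def[symmetric] by simp
  have D: "D > 0" and E: "E > 0"
    using cn_wave_den_pos[OF \<delta>, of C] cn_wave_den_pos[of "1 / \<delta>" C] jacobi_cn_bounds \<delta>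
    by (simp_all add: D_def E_def C_def)
  have z: "D * z = a * \<delta> * (1 + C) + b * (1 - C)"
    using D \<delta> by (simp add: z_def cn_wave_moebius D_def C_def)
  have v: "E * v = b * (1 / \<delta>) * (1 + C) + a * (1 - C)"
    using E \<delta> cn_wave_moebius[of "1 / \<delta>" b a \<nu> \<kappa> x] by (simp add: v_def cn_wave_S0_def E_def C_def)
  have \<delta>E: "\<delta> * E = (1 + C) + \<delta> * (1 - C)" using \<delta> by (simp add: E_def field_simps)
  have \<delta>v: "\<delta> * E * v = b * (1 + C) + a * \<delta> * (1 - C)"
    using \<delta> v by (simp add: field_simps)
  have Ka: "K + 2 * (a + b) * a = A" and Kb: "K + 2 * (a + b) * b = \<delta>\<^sup>2 * A"
    unfolding B[symmetric] by (simp_all add: K_def A_def power2_eq_square field_simps)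
  \<comment> \<open>Since \<open>z\<close> is a weighted mean of \<open>a\<close> and
    \<open>b\<close> with total weight \<open>D\<close>, an affine function of \<open>z\<close> is
    the same mean of its values at \<open>a\<close> and \<open>b\<close>.\<close>
  have "D * (K + 2 * (a + b) * z) = (K + 2 * (a + b) * a) * \<delta> * (1 + C) + (K + 2 * (a + b) * b) * (1 - C)"
    using z unfolding D_def by algebra
  also have "\<dots> = \<delta>\<^sup>2 * A * E" unfolding Ka Kb using \<delta>E by algebra
  finally have den: "D * (K + 2 * (a + b) * z) = \<delta>\<^sup>2 * A * E" .
  then show "K + 2 * (a + b) * z > 0"
    using A D E \<delta> by (metis mult_pos_pos zero_less_mult_pos zero_less_power)
  let ?q = "(a + b) * (a * b + (a + b)\<^sup>2 / 4 + \<beta>\<^sup>2)"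
  \<comment> \<open>The affine function on the right exchanges the endpoints: up to sign and the
    factors from \<open>Ka\<close> and \<open>Kb\<close>, it takes the value \<open>b\<close> at
    \<open>a\<close> and \<open>a\<close> at \<open>b\<close>.\<close>
  have qa: "K * a - ?q = - b * A" and qb: "K * b - ?q = - a * (\<delta>\<^sup>2 * A)"
    unfolding B[symmetric] by (simp_all add: K_def A_def power2_eq_square field_simps)
  have "D * (K * z - ?q) = (K * a - ?q) * \<delta> * (1 + C) + (K * b - ?q) * (1 - C)"
    using z unfolding D_def by algebra
  also have "\<dots> = - v * (\<delta>\<^sup>2 * A * E)"
    unfolding qa qb using \<delta>v by algebra
  also have "\<dots> = D * (- v * (K + 2 * (a + b) * z))"
    unfolding den[symmetric] by algebra
  finally show "- v * (K + 2 * (a + b) * z) = K * z - ?q"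
    using D by (metis mult_left_cancel less_irrefl)
qed

section \<open>The Darboux formulas in terms of the squares of the eigenfunctions\<close>

lemma darboux2_num_quadratic:
  "2 * darboux2_num l1 l2 p1 q1 p2 q2 =
     (l1\<^sup>2 - l2\<^sup>2) * (l1 * (2 * p1 * q1) * (p2\<^sup>2 + q2\<^sup>2) - l2 * (2 * p2 * q2) * (p1\<^sup>2 + q1\<^sup>2))"
  unfolding darboux2_num_def by algebra

lemma darboux2_den_quadratic:
  "darboux2_den l1 l2 p1 q1 p2 q2 =
     (l1\<^sup>2 + l2\<^sup>2) * (p1\<^sup>2 + q1\<^sup>2) * (p2\<^sup>2 + q2\<^sup>2)
     - 2 * l1 * l2 * ((2 * p1 * q1) * (2 * p2 * q2) + (p1\<^sup>2 - q1\<^sup>2) * (p2\<^sup>2 - q2\<^sup>2))"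
  unfolding darboux2_den_def by algebra

lemma darboux3_num_quadratic:
  assumes "P1 = p1\<^sup>2 + q1\<^sup>2" "M1 = p1\<^sup>2 - q1\<^sup>2" "R1 = 2 * p1 * q1"
    and "P2 = p2\<^sup>2 + q2\<^sup>2" "M2 = p2\<^sup>2 - q2\<^sup>2" "R2 = 2 * p2 * q2"
    and "P3 = p3\<^sup>2 + q3\<^sup>2" "M3 = p3\<^sup>2 - q3\<^sup>2" "R3 = 2 * p3 * q3"
  shows "2 * darboux3_num l1 l2 l3 p1 q1 p2 q2 p3 q3 =
     (l3\<^sup>2 - l1\<^sup>2) * (l3\<^sup>2 - l2\<^sup>2) * l3 * R3 * ((l1\<^sup>2 + l2\<^sup>2) * P1 * P2 - 2 * l1 * l2 * M1 * M2)
   + (l2\<^sup>2 - l1\<^sup>2) * (l2\<^sup>2 - l3\<^sup>2) * l2 * R2 * ((l1\<^sup>2 + l3\<^sup>2) * P1 * P3 - 2 * l1 * l3 * M1 * M3)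
   + (l1\<^sup>2 - l2\<^sup>2) * (l1\<^sup>2 - l3\<^sup>2) * l1 * R1 * ((l2\<^sup>2 + l3\<^sup>2) * P2 * P3 - 2 * l2 * l3 * M2 * M3)
   - 2 * (l1^4 + l2^4 + l3^4 - l1\<^sup>2 * l2\<^sup>2 - l1\<^sup>2 * l3\<^sup>2 - l2\<^sup>2 * l3\<^sup>2) * l1 * l2 * l3 * R1 * R2 * R3"
  unfolding darboux3_num_def assms by algebra

text \<open>Substitute half of \<open>P + M\<close> for the square of \<open>p\<close> and half of
  \<open>P - M\<close> for that of \<open>q\<close>. In each bracket the terms odd in the
  \<open>M\<close>s cancel, so the derivative of the wave will enter only through its
  square.\<close>

lemma darboux3_den_quadratic:
  assumes "P1 = p1\<^sup>2 + q1\<^sup>2" "M1 = p1\<^sup>2 - q1\<^sup>2" "R1 = 2 * p1 * q1"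
    and "P2 = p2\<^sup>2 + q2\<^sup>2" "M2 = p2\<^sup>2 - q2\<^sup>2" "R2 = 2 * p2 * q2"
    and "P3 = p3\<^sup>2 + q3\<^sup>2" "M3 = p3\<^sup>2 - q3\<^sup>2" "R3 = 2 * p3 * q3"
  shows "4 * darboux3_den l1 l2 l3 p1 q1 p2 q2 p3 q3 =
     (l1 + l2)\<^sup>2 * (l1 + l3)\<^sup>2 * (l2 - l3)\<^sup>2 * (P1 * P2 * P3 + P1 * M2 * M3 - P2 * M1 * M3 - P3 * M1 * M2)
   + (l1 + l2)\<^sup>2 * (l2 + l3)\<^sup>2 * (l1 - l3)\<^sup>2 * (P1 * P2 * P3 + P2 * M1 * M3 - P1 * M2 * M3 - P3 * M1 * M2)
   + (l1 + l3)\<^sup>2 * (l2 + l3)\<^sup>2 * (l1 - l2)\<^sup>2 * (P1 * P2 * P3 + P3 * M1 * M2 - P1 * M2 * M3 - P2 * M1 * M3)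
   + (l1 - l2)\<^sup>2 * (l1 - l3)\<^sup>2 * (l2 - l3)\<^sup>2 * (P1 * P2 * P3 + P1 * M2 * M3 + P2 * M1 * M3 + P3 * M1 * M2)
   - 8 * (l3\<^sup>2 - l1\<^sup>2) * (l3\<^sup>2 - l2\<^sup>2) * l1 * l2 * R1 * R2 * P3
   - 8 * (l2\<^sup>2 - l1\<^sup>2) * (l2\<^sup>2 - l3\<^sup>2) * l1 * l3 * R1 * R3 * P2
   - 8 * (l1\<^sup>2 - l2\<^sup>2) * (l1\<^sup>2 - l3\<^sup>2) * l2 * l3 * R2 * R3 * P1"
  unfolding darboux3_den_def assms by algebra

text \<open>
  For \<open>l1, l2, l3\<close> as in the theorem, \<open>c = 2 * (l1\<^sup>2 + l2\<^sup>2 + l3\<^sup>2)\<close> and \<open>e = 4 * l1 * l2 * l3\<close>.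
  This turns the defining relations of a periodic eigenfunction for \<open>l1\<close> into the following ones,
  with \<open>n = 2 * m * l1\<close>, \<open>z\<close> the value of the wave and \<open>w\<close> the value of its derivative.
\<close>

definition wave_squares ::
    "complex \<Rightarrow> complex \<Rightarrow> complex \<Rightarrow> complex \<Rightarrow> complex \<Rightarrow> complex \<Rightarrow> complex \<Rightarrow> complex \<Rightarrow> bool" where
  "wave_squares l1 l2 l3 z w n p q \<longleftrightarrow> n \<noteq> 0 \<and>
     p\<^sup>2 + q\<^sup>2 = n * (2 * (l2 * l3 + l1 * z)) \<and>
     p\<^sup>2 - q\<^sup>2 = n * w \<and>
     2 * p * q = n * (l2\<^sup>2 + l3\<^sup>2 - l1\<^sup>2 - z\<^sup>2)"

lemma periodic_eigenfunction_wave_squares: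
  assumes "periodic_eigenfunction c e u l p q" "l \<noteq> 0"
    and "of_real c = 2 * (l\<^sup>2 + l2\<^sup>2 + l3\<^sup>2)" "of_real e = 4 * l * l2 * l3"
  shows "\<exists>n. \<forall>x. wave_squares l l2 l3 (of_real (u x)) (of_real (deriv u x)) n (p x) (q x)"
proof -
  obtain m where m: "m \<noteq> 0"
    "\<And>x. (p x)\<^sup>2 + (q x)\<^sup>2 = m * (of_real e + 4 * l\<^sup>2 * of_real (u x))"
    "\<And>x. (p x)\<^sup>2 - (q x)\<^sup>2 = 2 * m * l * of_real (deriv u x)"
    "\<And>x. 2 * p x * q x = m * l * (of_real c - 4 * l\<^sup>2 - 2 * of_real ((u x)\<^sup>2))"
    using assms(1) unfolding periodic_eigenfunction_def by blast
  have "wave_squares l l2 l3 (of_real (u x)) (of_real (deriv u x)) (2 * m * l) (p x) (q x)" for x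
    unfolding wave_squares_def m(2-4) assms(3,4) of_real_power using m(1) assms(2)
    by (simp add: algebra_simps power2_eq_square)
  then show ?thesis by blast
qed

text \<open>The first integral of the wave equation, from \<open>(p\<^sup>2 + q\<^sup>2)\<^sup>2 = (p\<^sup>2 - q\<^sup>2)\<^sup>2 + (2 * p * q)\<^sup>2\<close>.\<close>

lemma wave_squares_first_integral:
  assumes "wave_squares l1 l2 l3 z w n p q"
  shows "w\<^sup>2 = 4 * (l2 * l3 + l1 * z)\<^sup>2 - (l2\<^sup>2 + l3\<^sup>2 - l1\<^sup>2 - z\<^sup>2)\<^sup>2"
proof -
  have "(p\<^sup>2 + q\<^sup>2)\<^sup>2 = (p\<^sup>2 - q\<^sup>2)\<^sup>2 + (2 * p * q)\<^sup>2" by algebra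
  then have "n\<^sup>2 * (4 * (l2 * l3 + l1 * z)\<^sup>2) = n\<^sup>2 * (w\<^sup>2 + (l2\<^sup>2 + l3\<^sup>2 - l1\<^sup>2 - z\<^sup>2)\<^sup>2)"
    using assms unfolding wave_squares_def
    by algebra
  then show ?thesis using assms by (simp add: wave_squares_def)
qed

section \<open>Evaluation of the three transformations at a point\<close>

text \<open>Over the common denominator the quadratic terms in \<open>z\<close> cancel, which leaves
  the fractional linear function \<open>v\<close> of \<open>z\<close>.\<close>

lemma darboux1_wave:
  assumes "wave_squares l3 l1 l2 z w n p q" and "l1 * l2 + l3 * z \<noteq> 0"
    and v: "v * (l1 * l2 + l3 * z) = l1 * l2 * z + l3 * (l1\<^sup>2 + l2\<^sup>2 - l3\<^sup>2)"
  shows "darboux1_den p q \<noteq> 0" and "z + 4 * darboux1_num l3 p q / darboux1_den p q = v"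
proof -
  have den: "darboux1_den p q = n * (2 * (l1 * l2 + l3 * z))" and n: "n \<noteq> 0"
    using assms(1) by (simp_all add: wave_squares_def darboux1_den_def)
  have num: "2 * darboux1_num l3 p q = l3 * (n * (l1\<^sup>2 + l2\<^sup>2 - l3\<^sup>2 - z\<^sup>2))"
    using assms(1) by (simp add: wave_squares_def darboux1_num_def ac_simps)
  show nz: "darboux1_den p q \<noteq> 0" unfolding den using n assms(2) by (simp only: mult_eq_0_iff) simp
  have "z * darboux1_den p q + 4 * darboux1_num l3 p q = v * darboux1_den p q"
    using den num v by algebra
  then show "z + 4 * darboux1_num l3 p q / darboux1_den p q = v"
    using nz by (simp add: field_simps)
qed

text \<open>Numerator and denominator share the factor
  \<open>n1 * n2 * (l1\<^sup>2 - l2\<^sup>2)\<^sup>2\<close>. What remains of the denominator is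
  that of the one-fold case up to a constant, and the value is the opposite one.\<close>

lemma darboux2_wave:
  assumes h1: "wave_squares l1 l2 l3 z w n1 p1 q1" and h2: "wave_squares l2 l1 l3 z w n2 p2 q2"
    and "l1\<^sup>2 \<noteq> l2\<^sup>2" and "l1 * l2 + l3 * z \<noteq> 0"
    and v: "v * (l1 * l2 + l3 * z) = l1 * l2 * z + l3 * (l1\<^sup>2 + l2\<^sup>2 - l3\<^sup>2)"
  shows "darboux2_den l1 l2 p1 q1 p2 q2 \<noteq> 0"
    and "z + 4 * darboux2_num l1 l2 p1 q1 p2 q2 / darboux2_den l1 l2 p1 q1 p2 q2 = - v"
proof -
  note s1 = h1[unfolded wave_squares_def] and s2 = h2[unfolded wave_squares_def]
  have "2 * darboux2_num l1 l2 p1 q1 p2 q2 =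
      2 * n1 * n2 * (l1\<^sup>2 - l2\<^sup>2)\<^sup>2 * (l3 * (l3\<^sup>2 - l1\<^sup>2 - l2\<^sup>2 - z\<^sup>2) - 2 * l1 * l2 * z)"
    unfolding darboux2_num_quadratic by (simp only: s1 s2) algebra
  then have num: "darboux2_num l1 l2 p1 q1 p2 q2 =
      n1 * n2 * (l1\<^sup>2 - l2\<^sup>2)\<^sup>2 * (l3 * (l3\<^sup>2 - l1\<^sup>2 - l2\<^sup>2 - z\<^sup>2) - 2 * l1 * l2 * z)"
    by simp
  have "darboux2_den l1 l2 p1 q1 p2 q2 =
      n1 * n2 * ((l1\<^sup>2 + l2\<^sup>2) * (2 * (l2 * l3 + l1 * z)) * (2 * (l1 * l3 + l2 * z))
        - 2 * l1 * l2 * ((l2\<^sup>2 + l3\<^sup>2 - l1\<^sup>2 - z\<^sup>2) * (l1\<^sup>2 + l3\<^sup>2 - l2\<^sup>2 - z\<^sup>2) + w\<^sup>2))"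
    unfolding darboux2_den_quadratic by (simp only: s1 s2) algebra
  \<comment> \<open>The first integral removes \<open>w\<close> and makes all powers of
    \<open>z\<close> above the first cancel.\<close>
  also have "\<dots> = 4 * n1 * n2 * (l1\<^sup>2 - l2\<^sup>2)\<^sup>2 * (l1 * l2 + l3 * z)"
    unfolding wave_squares_first_integral[OF h1] by algebra
  finally have den: "darboux2_den l1 l2 p1 q1 p2 q2 = \<dots>" .
  show nz: "darboux2_den l1 l2 p1 q1 p2 q2 \<noteq> 0" unfolding den using s1 s2 assms(3,4) by (simp only: mult_eq_0_iff power_eq_0_iff right_minus_eq) simp
  have "z * darboux2_den l1 l2 p1 q1 p2 q2 + 4 * darboux2_num l1 l2 p1 q1 p2 q2
      = - v * darboux2_den l1 l2 p1 q1 p2 q2"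
    using den num v by algebra
  then show "z + 4 * darboux2_num l1 l2 p1 q1 p2 q2 / darboux2_den l1 l2 p1 q1 p2 q2 = - v"
    using nz by (simp add: field_simps)
qed

text \<open>After elimination of \<open>w\<close> the numerator is a multiple of \<open>z\<close>
  and the denominator is free of \<open>z\<close>; their quotient is \<open>- z / 2\<close>.\<close>

lemma darboux3_wave:
  assumes h1: "wave_squares l1 l2 l3 z w n1 p1 q1" and h2: "wave_squares l2 l1 l3 z w n2 p2 q2"
    and h3: "wave_squares l3 l1 l2 z w n3 p3 q3"
    and "l1\<^sup>2 \<noteq> l2\<^sup>2" "l1\<^sup>2 \<noteq> l3\<^sup>2" "l2\<^sup>2 \<noteq> l3\<^sup>2"
  shows "darboux3_den l1 l2 l3 p1 q1 p2 q2 p3 q3 \<noteq> 0"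
    and "z + 4 * darboux3_num l1 l2 l3 p1 q1 p2 q2 p3 q3
           / darboux3_den l1 l2 l3 p1 q1 p2 q2 p3 q3 = - z"
proof -
  note s1 = h1[unfolded wave_squares_def] and s2 = h2[unfolded wave_squares_def]
    and s3 = h3[unfolded wave_squares_def]
  define P1 P2 P3 where "P1 = 2 * (l2 * l3 + l1 * z)" and "P2 = 2 * (l1 * l3 + l2 * z)"
    and "P3 = 2 * (l1 * l2 + l3 * z)"
  define R1 R2 R3 where "R1 = l2\<^sup>2 + l3\<^sup>2 - l1\<^sup>2 - z\<^sup>2" and "R2 = l1\<^sup>2 + l3\<^sup>2 - l2\<^sup>2 - z\<^sup>2"
    and "R3 = l1\<^sup>2 + l2\<^sup>2 - l3\<^sup>2 - z\<^sup>2"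
  note PR = P1_def P2_def P3_def R1_def R2_def R3_def
  have P: "n1 * P1 = p1\<^sup>2 + q1\<^sup>2" "n2 * P2 = p2\<^sup>2 + q2\<^sup>2" "n3 * P3 = p3\<^sup>2 + q3\<^sup>2"
    and M: "n1 * w = p1\<^sup>2 - q1\<^sup>2" "n2 * w = p2\<^sup>2 - q2\<^sup>2" "n3 * w = p3\<^sup>2 - q3\<^sup>2"
    and R: "n1 * R1 = 2 * p1 * q1" "n2 * R2 = 2 * p2 * q2" "n3 * R3 = 2 * p3 * q3"
    using s1 s2 s3 unfolding PR by (simp_all only:)
  \<comment> \<open>\<open>V\<close> is the discriminant of the cubic with roots
    \<open>l1\<^sup>2\<close>, \<open>l2\<^sup>2\<close>, \<open>l3\<^sup>2\<close>; it is nonzero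
    because they are distinct.\<close>
  define V where "V = (l1\<^sup>2 - l2\<^sup>2)\<^sup>2 * (l1\<^sup>2 - l3\<^sup>2)\<^sup>2 * (l2\<^sup>2 - l3\<^sup>2)\<^sup>2"
  \<comment> \<open>The first integral is symmetric in \<open>l1\<close>, \<open>l2\<close>,
    \<open>l3\<close>, so the one from \<open>h1\<close> serves for all three
    eigenfunctions.\<close>
  have w: "w\<^sup>2 = P1\<^sup>2 - R1\<^sup>2"
    using wave_squares_first_integral[OF h1] unfolding PR by algebra
  note PMR = P(1) M(1) R(1) P(2) M(2) R(2) P(3) M(3) R(3)
  have "2 * darboux3_num l1 l2 l3 p1 q1 p2 q2 p3 q3 = n1 * n2 * n3 * (
       (l3\<^sup>2 - l1\<^sup>2) * (l3\<^sup>2 - l2\<^sup>2) * l3 * R3 * ((l1\<^sup>2 + l2\<^sup>2) * P1 * P2 - 2 * l1 * l2 * w\<^sup>2)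
     + (l2\<^sup>2 - l1\<^sup>2) * (l2\<^sup>2 - l3\<^sup>2) * l2 * R2 * ((l1\<^sup>2 + l3\<^sup>2) * P1 * P3 - 2 * l1 * l3 * w\<^sup>2)
     + (l1\<^sup>2 - l2\<^sup>2) * (l1\<^sup>2 - l3\<^sup>2) * l1 * R1 * ((l2\<^sup>2 + l3\<^sup>2) * P2 * P3 - 2 * l2 * l3 * w\<^sup>2)
     - 2 * (l1^4 + l2^4 + l3^4 - l1\<^sup>2 * l2\<^sup>2 - l1\<^sup>2 * l3\<^sup>2 - l2\<^sup>2 * l3\<^sup>2) * l1 * l2 * l3 * R1 * R2 * R3)"
    unfolding darboux3_num_quadratic[OF PMR] by algebra
  also have "\<dots> = n1 * n2 * n3 * (- 8 * z * V)"
    unfolding w V_def PR by algebra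
  finally have num: "darboux3_num l1 l2 l3 p1 q1 p2 q2 p3 q3 = - 4 * z * (n1 * n2 * n3 * V)"
    by simp
  have "4 * darboux3_den l1 l2 l3 p1 q1 p2 q2 p3 q3 = n1 * n2 * n3 * (
       (l1 + l2)\<^sup>2 * (l1 + l3)\<^sup>2 * (l2 - l3)\<^sup>2 * (P1 * P2 * P3 + w\<^sup>2 * (P1 - P2 - P3))
     + (l1 + l2)\<^sup>2 * (l2 + l3)\<^sup>2 * (l1 - l3)\<^sup>2 * (P1 * P2 * P3 + w\<^sup>2 * (P2 - P1 - P3))
     + (l1 + l3)\<^sup>2 * (l2 + l3)\<^sup>2 * (l1 - l2)\<^sup>2 * (P1 * P2 * P3 + w\<^sup>2 * (P3 - P1 - P2))
     + (l1 - l2)\<^sup>2 * (l1 - l3)\<^sup>2 * (l2 - l3)\<^sup>2 * (P1 * P2 * P3 + w\<^sup>2 * (P1 + P2 + P3))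
     - 8 * (l3\<^sup>2 - l1\<^sup>2) * (l3\<^sup>2 - l2\<^sup>2) * l1 * l2 * R1 * R2 * P3
     - 8 * (l2\<^sup>2 - l1\<^sup>2) * (l2\<^sup>2 - l3\<^sup>2) * l1 * l3 * R1 * R3 * P2
     - 8 * (l1\<^sup>2 - l2\<^sup>2) * (l1\<^sup>2 - l3\<^sup>2) * l2 * l3 * R2 * R3 * P1)"
    unfolding darboux3_den_quadratic[OF PMR] by algebra
  also have "\<dots> = n1 * n2 * n3 * (32 * V)"
    unfolding w V_def PR by algebra
  finally have den: "darboux3_den l1 l2 l3 p1 q1 p2 q2 p3 q3 = 8 * (n1 * n2 * n3 * V)"
    by simp
  have nV: "n1 * n2 * n3 * V \<noteq> 0"
    using s1 s2 s3 assms(4-6) by (simp add: V_def)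
  then show "darboux3_den l1 l2 l3 p1 q1 p2 q2 p3 q3 \<noteq> 0"
    unfolding den by simp
  show "z + 4 * darboux3_num l1 l2 l3 p1 q1 p2 q2 p3 q3
           / darboux3_den l1 l2 l3 p1 q1 p2 q2 p3 q3 = - z"
    unfolding num den using nV by simp
qed

section \<open>The transformed waves and their periods\<close>

theorem theorem4:
  fixes a b \<alpha> \<beta> \<delta> \<nu> \<kappa> c e :: real
    and u :: "real \<Rightarrow> real"
    and l1 l2 l3 :: complex
  assumes "b \<le> a" and "\<beta> \<noteq> 0" and "a \<noteq> b" and "a \<noteq> - b"
    and "\<alpha> = - (a + b) / 2"
    and "cn_wave_parameters a b \<alpha> \<beta> \<delta> \<nu> \<kappa>"
    and "u = cn_wave a b \<delta> \<nu> \<kappa>"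
    and "c = mkdv_c a b \<alpha> \<beta>" and "e = mkdv_e a b \<alpha> \<beta>"
    and "l1 = of_real ((a - b) / 4) + \<i> / 2 * of_real \<beta>"
    and "l2 = of_real ((a - b) / 4) - \<i> / 2 * of_real \<beta>"
    and "l3 = of_real ((a + b) / 2)"
  shows
    "(\<forall>p3 q3. periodic_eigenfunction c e u l3 p3 q3 \<longrightarrow>
        (\<forall>x. darboux1_den (p3 x) (q3 x) \<noteq> 0) \<and>
        darboux1 u l3 p3 q3 = (\<lambda>x. of_real (- cn_wave_S0 a b \<delta> \<nu> \<kappa> x)) \<and>
        (\<exists>T. fundamental_period u T \<and> fundamental_period (darboux1 u l3 p3 q3) T))
     \<and>
     (\<forall>p1 q1 p2 q2.
        periodic_eigenfunction c e u l1 p1 q1 \<and> periodic_eigenfunction c e u l2 p2 q2 \<longrightarrow>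
        (\<forall>x. darboux2_den l1 l2 (p1 x) (q1 x) (p2 x) (q2 x) \<noteq> 0) \<and>
        darboux2 u l1 l2 p1 q1 p2 q2 = (\<lambda>x. of_real (cn_wave_S0 a b \<delta> \<nu> \<kappa> x)) \<and>
        (\<exists>T. fundamental_period u T \<and> fundamental_period (darboux2 u l1 l2 p1 q1 p2 q2) T))
     \<and>
     (\<forall>p1 q1 p2 q2 p3 q3.
        periodic_eigenfunction c e u l1 p1 q1 \<and> periodic_eigenfunction c e u l2 p2 q2 \<and>
        periodic_eigenfunction c e u l3 p3 q3 \<longrightarrow>
        (\<forall>x. darboux3_den l1 l2 l3 (p1 x) (q1 x) (p2 x) (q2 x) (p3 x) (q3 x) \<noteq> 0) \<and>
        darboux3 u l1 l2 l3 p1 q1 p2 q2 p3 q3 = (\<lambda>x. of_real (- u x)))"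
proof (intro conjI allI impI; (elim conjE)?)
  note \<alpha>_eq = assms(5)
  have minus_\<alpha>: "a - \<alpha> = a + (a + b) / 2" "b - \<alpha> = b + (a + b) / 2"
    by (simp_all add: \<alpha>_eq field_simps)
  have par: "\<delta> > 0" "\<nu> > 0" "0 < \<kappa>" "\<kappa> < 1"
    and \<delta>2: "\<delta>\<^sup>2 = ((b + (a + b) / 2)\<^sup>2 + \<beta>\<^sup>2) / ((a + (a + b) / 2)\<^sup>2 + \<beta>\<^sup>2)"
    using assms(6) by (simp_all add: cn_wave_parameters_def minus_\<alpha>)
  note l_defs = assms(10-12)
  define K where "K = (a - b)\<^sup>2 / 4 + \<beta>\<^sup>2"
  have l12: "l1 * l2 = of_real (K / 4)"
    by (simp add: complex_eq_iff l_defs K_def power2_eq_square field_simps)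
  have l1_sq: "l1\<^sup>2 = Complex ((a - b)\<^sup>2 / 16 - \<beta>\<^sup>2 / 4) ((a - b) * \<beta> / 4)"
    and l2_sq: "l2\<^sup>2 = Complex ((a - b)\<^sup>2 / 16 - \<beta>\<^sup>2 / 4) (- ((a - b) * \<beta> / 4))"
    by (simp_all add: complex_eq_iff l_defs power2_eq_square field_simps)
  have l3_sq: "l3\<^sup>2 = of_real ((a + b)\<^sup>2 / 4)"
    by (simp add: l_defs power_divide)
  have nz: "l1 \<noteq> 0" "l2 \<noteq> 0" "l3 \<noteq> 0"
    using \<open>\<beta> \<noteq> 0\<close> \<open>a \<noteq> - b\<close> by (auto simp: complex_eq_iff l_defs)
  \<comment> \<open>The squares of \<open>l1\<close> and \<open>l2\<close> have opposite nonzero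
    imaginary parts, and that of \<open>l3\<close> is real.\<close>
  have sq_ne: "l1\<^sup>2 \<noteq> l2\<^sup>2" "l1\<^sup>2 \<noteq> l3\<^sup>2" "l2\<^sup>2 \<noteq> l3\<^sup>2"
    using \<open>\<beta> \<noteq> 0\<close> \<open>a \<noteq> b\<close> by (auto simp: l1_sq l2_sq l3_sq complex_eq_iff)
  have c_eq: "of_real c = 2 * (l1\<^sup>2 + l2\<^sup>2 + l3\<^sup>2)"
    unfolding l1_sq l2_sq l3_sq
    by (simp add: complex_eq_iff assms(8) mkdv_c_def \<alpha>_eq power2_eq_square field_simps)
  have "e = 4 * (K / 4) * ((a + b) / 2)"
    by (simp add: assms(9) mkdv_e_def \<alpha>_eq K_def power2_eq_square field_simps)
  then have "complex_of_real e = 4 * of_real (K / 4) * of_real ((a + b) / 2)"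
    by (simp only: of_real_mult of_real_numeral)
  then have e_eq: "of_real e = 4 * l1 * l2 * l3"
    by (simp only: mult.assoc flip: l12 l_defs(3))

  define v where "v = cn_wave_S0 a b \<delta> \<nu> \<kappa>"
  have v_eq: "- v x * (K + 2 * (a + b) * u x) = K * u x - (a + b) * (a * b + (a + b)\<^sup>2 / 4 + \<beta>\<^sup>2)"
    and den_pos: "K + 2 * (a + b) * u x > 0" for x
    using cn_wave_S0_moebius[OF \<open>\<beta> \<noteq> 0\<close> par(1) \<delta>2] by (simp_all add: v_def K_def assms(7))
  have den: "l1 * l2 + l3 * of_real (u x) = of_real ((K + 2 * (a + b) * u x) / 4)" for x
    unfolding l12 l_defs(3) by (simp add: field_simps)
  have den_nz: "l1 * l2 + l3 * of_real (u x) \<noteq> 0" for x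
    using den_pos[of x] unfolding den of_real_eq_0_iff by simp
  have l123: "l1\<^sup>2 + l2\<^sup>2 - l3\<^sup>2 = of_real (- (a * b + (a + b)\<^sup>2 / 4 + \<beta>\<^sup>2) / 2)"
    unfolding l1_sq l2_sq l3_sq by (simp add: complex_eq_iff power2_eq_square field_simps)
  have num: "l1 * l2 * of_real (u x) + l3 * (l1\<^sup>2 + l2\<^sup>2 - l3\<^sup>2)
      = of_real ((K * u x - (a + b) * (a * b + (a + b)\<^sup>2 / 4 + \<beta>\<^sup>2)) / 4)" for x
    unfolding l12 l123 unfolding l_defs(3) by (simp add: field_simps)
  \<comment> \<open>Thus \<open>- v x\<close> is the value required in \<open>darboux1_wave\<close>
    and \<open>darboux2_wave\<close>: the one-fold result is the reflected (S0) wave, the two-fold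
    result the (S0) wave itself.\<close>
  have v_rel: "of_real (- v x) * (l1 * l2 + l3 * of_real (u x))
      = l1 * l2 * of_real (u x) + l3 * (l1\<^sup>2 + l2\<^sup>2 - l3\<^sup>2)" for x
    unfolding den num v_eq[symmetric] by simp

  define T where "T = elliptic_F (2 * pi) \<kappa> / \<nu>"
  have cn_period: "fundamental_period (\<lambda>x. jacobi_cn (\<nu> * x) \<kappa>) T"
    unfolding T_def by (rule fundamental_period_jacobi_cn[OF par(3,4,2)])
  note period_cn = fundamental_period_cong_ker[THEN iffD2, OF _ cn_period]
  have u_inj: "u x = u y \<longleftrightarrow> jacobi_cn (\<nu> * x) \<kappa> = jacobi_cn (\<nu> * y) \<kappa>" for x y
    unfolding assms(7) by (rule cn_wave_eq_iff[OF par(1) \<open>a \<noteq> b\<close>])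
  have u_period: "fundamental_period u T"
    by (rule period_cn) (rule u_inj)
  have v_inj: "v x = v y \<longleftrightarrow> jacobi_cn (\<nu> * x) \<kappa> = jacobi_cn (\<nu> * y) \<kappa>" for x y
    unfolding v_def cn_wave_S0_def using par(1) \<open>a \<noteq> b\<close> by (intro cn_wave_eq_iff) auto
  have v_period: "fundamental_period (\<lambda>x. complex_of_real (v x)) T"
    and neg_v_period: "fundamental_period (\<lambda>x. complex_of_real (- v x)) T"
    by (rule period_cn, simp add: v_inj)+

  have sq1: "\<exists>n. \<forall>x. wave_squares l1 l2 l3 (of_real (u x)) (of_real (deriv u x)) n (p x) (q x)"
    if "periodic_eigenfunction c e u l1 p q" for p q
    using periodic_eigenfunction_wave_squares[OF that nz(1) c_eq e_eq] .
  \<comment> \<open>The expressions for \<open>c\<close> and \<open>e\<close> are symmetric in the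
    three eigenvalues, so their roles may be permuted.\<close>
  have sq2: "\<exists>n. \<forall>x. wave_squares l2 l1 l3 (of_real (u x)) (of_real (deriv u x)) n (p x) (q x)"
    if "periodic_eigenfunction c e u l2 p q" for p q
    by (rule periodic_eigenfunction_wave_squares[OF that nz(2)]) (simp_all add: c_eq e_eq)
  have sq3: "\<exists>n. \<forall>x. wave_squares l3 l1 l2 (of_real (u x)) (of_real (deriv u x)) n (p x) (q x)"
    if "periodic_eigenfunction c e u l3 p q" for p q
    by (rule periodic_eigenfunction_wave_squares[OF that nz(3)]) (simp_all add: c_eq e_eq)

  {
    fix p3 q3 assume "periodic_eigenfunction c e u l3 p3 q3"
    then obtain n where n: "\<And>x. wave_squares l3 l1 l2 (of_real (u x)) (of_real (deriv u x)) n (p3 x) (q3 x)"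
      using sq3 by blast
    note res = darboux1_wave[OF n den_nz v_rel]
    show "darboux1_den (p3 x) (q3 x) \<noteq> 0" for x by (rule res)
    have eq: "darboux1 u l3 p3 q3 = (\<lambda>x. of_real (- v x))"
      unfolding darboux1_def using res(2) by blast
    then show "darboux1 u l3 p3 q3 = (\<lambda>x. of_real (- cn_wave_S0 a b \<delta> \<nu> \<kappa> x))"
      by (simp add: v_def)
    show "\<exists>T. fundamental_period u T \<and> fundamental_period (darboux1 u l3 p3 q3) T"
      unfolding eq using u_period neg_v_period by blast
  next
    fix p1 q1 p2 q2
    assume "periodic_eigenfunction c e u l1 p1 q1" "periodic_eigenfunction c e u l2 p2 q2"
    then obtain n1 n2 where n:
      "\<And>x. wave_squares l1 l2 l3 (of_real (u x)) (of_real (deriv u x)) n1 (p1 x) (q1 x)"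
      "\<And>x. wave_squares l2 l1 l3 (of_real (u x)) (of_real (deriv u x)) n2 (p2 x) (q2 x)"
      using sq1 sq2 by blast
    note res = darboux2_wave[OF n sq_ne(1) den_nz v_rel]
    show "darboux2_den l1 l2 (p1 x) (q1 x) (p2 x) (q2 x) \<noteq> 0" for x by (rule res)
    have eq: "darboux2 u l1 l2 p1 q1 p2 q2 = (\<lambda>x. of_real (v x))"
      unfolding darboux2_def using res(2) by simp
    then show "darboux2 u l1 l2 p1 q1 p2 q2 = (\<lambda>x. of_real (cn_wave_S0 a b \<delta> \<nu> \<kappa> x))"
      by (simp add: v_def)
    show "\<exists>T. fundamental_period u T \<and> fundamental_period (darboux2 u l1 l2 p1 q1 p2 q2) T"
      unfolding eq using u_period v_period by blast
  next
    fix p1 q1 p2 q2 p3 q3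
    assume "periodic_eigenfunction c e u l1 p1 q1" "periodic_eigenfunction c e u l2 p2 q2"
      "periodic_eigenfunction c e u l3 p3 q3"
    then obtain n1 n2 n3 where n:
      "\<And>x. wave_squares l1 l2 l3 (of_real (u x)) (of_real (deriv u x)) n1 (p1 x) (q1 x)"
      "\<And>x. wave_squares l2 l1 l3 (of_real (u x)) (of_real (deriv u x)) n2 (p2 x) (q2 x)"
      "\<And>x. wave_squares l3 l1 l2 (of_real (u x)) (of_real (deriv u x)) n3 (p3 x) (q3 x)"
      using sq1 sq2 sq3 by meson
    note res = darboux3_wave[OF n sq_ne]
    show "darboux3_den l1 l2 l3 (p1 x) (q1 x) (p2 x) (q2 x) (p3 x) (q3 x) \<noteq> 0" for x by (rule res)
    show "darboux3 u l1 l2 l3 p1 q1 p2 q2 p3 q3 = (\<lambda>x. of_real (- u x))"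
      unfolding darboux3_def of_real_minus by (rule ext) (rule res(2))
  }
qed

end
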